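(* Let $\mathbf{x}\in L^2(\mathbb{R})$, $t_0\in\mathbb{R}$, $k\in\mathbb{Q}^+$ and $\theta\in\mathbb{R}$ with $\theta\notin\pi\mathbb{Z}$. Let $\mathbf{y}(t)=\mathbf{x}(t-t_0)$. Then for $\tau,u\in\mathbb{R}$, $$\mathcal{A}^{\theta,k}_{\mathbf{y}}(\tau,u)=e^{it_0(k\tau\cot\theta-u\csc\theta)}\,\mathcal{A}^{\theta,k}_{\mathbf{x}}(\tau,u).$$
   Context: Superscript $*$ denotes complex conjugation. $\Omega_\theta=\sqrt{(1-i\cot\theta)/2\pi}$, so $|\Omega_\theta|^2=|\csc\theta|/(2\pi)$. The new fractional ambiguity function (NFrAF) of $\mathbf{x}\in L^2(\mathbb{R})$ with parameters $(\theta,k)$ is $$\mathcal{A}^{\theta,k}_{\mathbf{x}}(\tau,u)=|\Omega_\theta|^2\int_{\mathbb{R}}\mathbf{x}\left(t+k\tfrac{\tau}{2}\right)\mathbf{x}^*\left(t-k\tfrac{\tau}{2}\right)e^{it(k\tau\cot\theta-u\csc\theta)}\,dt.$$ *)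

theory Defs
  imports "HOL-Analysis.Analysis"
begin

(* Elements of this set are representatives: complex-valued functions, not identified
   up to equality almost everywhere. *)
definition L2_functions :: "(real \<Rightarrow> complex) set" where
  "L2_functions =
     {x \<in> borel_measurable lebesgue. integrable lebesgue (\<lambda>t. (cmod (x t))\<^sup>2)}"

definition csc :: "real \<Rightarrow> real" where
  "csc \<theta> = 1 / sin \<theta>"

definition Omega :: "real \<Rightarrow> complex" where
  "Omega \<theta> = csqrt ((1 - \<i> * of_real (cot \<theta>)) / of_real (2 * pi))"

lemma norm_Omega_squared:
  assumes "sin \<theta> \<noteq> 0"
  shows "(cmod (Omega \<theta>))\<^sup>2 = \<bar>csc \<theta>\<bar> / (2 * pi)"
proof -
  have "(sin \<theta>)\<^sup>2 + (cos \<theta>)\<^sup>2 = 1" by simp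
  then have "1 + (cot \<theta>)\<^sup>2 = (csc \<theta>)\<^sup>2"
    using assms by (simp add: cot_def csc_def field_simps)
  then have "cmod (1 - \<i> * of_real (cot \<theta>)) = \<bar>csc \<theta>\<bar>"
    by (simp add: cmod_def)
  moreover have "(cmod (Omega \<theta>))\<^sup>2 = cmod ((Omega \<theta>)\<^sup>2)"
    by (simp add: norm_power)
  ultimately show ?thesis
    by (simp add: Omega_def norm_divide norm_mult)
qed

definition NFrAF :: "real \<Rightarrow> real \<Rightarrow> (real \<Rightarrow> complex) \<Rightarrow> real \<Rightarrow> real \<Rightarrow> complex" where
  "NFrAF \<theta> k x \<tau> u =
     of_real ((cmod (Omega \<theta>))\<^sup>2) *
     (LINT t|lebesgue.
        x (t + k * (\<tau> / 2)) * cnj (x (t - k * (\<tau> / 2))) *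
        exp (\<i> * of_real (t * (k * \<tau> * cot \<theta> - u * csc \<theta>))))"

end

theory Submission
  imports Defs
begin

text \<open>
  The substitution \<open>t = s + t0\<close> turns the integrand of \<open>y\<close> into that of \<open>x\<close>, except that the phase
  \<open>t * (k * \<tau> * cot \<theta> - u * csc \<theta>)\<close>, being linear in \<open>t\<close>, leaves behind the constant factor
  \<open>exp (\<i> * t0 * (k * \<tau> * cot \<theta> - u * csc \<theta>))\<close>. Translation invariance of the Lebesgue integral
  then gives the claim.
\<close>

theorem mainTheorem6:
  fixes x y :: "real \<Rightarrow> complex" and t0 k \<theta> \<tau> u :: real
  assumes "x \<in> L2_functions"
    and "k \<in> \<rat>" and "k > 0"
    and "\<And>n :: int. \<theta> \<noteq> of_int n * pi"
    and "\<And>t. y t = x (t - t0)"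
  shows "NFrAF \<theta> k y \<tau> u =
           exp (\<i> * of_real (t0 * (k * \<tau> * cot \<theta> - u * csc \<theta>))) * NFrAF \<theta> k x \<tau> u"
proof -
  define \<omega> where "\<omega> = k * \<tau> * cot \<theta> - u * csc \<theta>"
  define f where
    "f z t = z (t + k * (\<tau> / 2)) * cnj (z (t - k * (\<tau> / 2))) * exp (\<i> * of_real (t * \<omega>))"
    for z :: "real \<Rightarrow> complex" and t :: real
  have NFrAF: "NFrAF \<theta> k z \<tau> u = of_real ((cmod (Omega \<theta>))\<^sup>2) * (LINT t|lebesgue. f z t)" for z
    by (simp add: NFrAF_def f_def \<omega>_def)
  have shifted: "f y (t0 + t) = exp (\<i> * of_real (t0 * \<omega>)) * f x t" for t
  proof -
    have "exp (\<i> * of_real ((t0 + t) * \<omega>)) = exp (\<i> * of_real (t0 * \<omega>)) * exp (\<i> * of_real (t * \<omega>))"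
      by (simp add: exp_add [symmetric] algebra_simps)
    then show ?thesis
      by (simp add: f_def assms(5) algebra_simps)
  qed
  have "(LINT t|lebesgue. f y t) = (LINT t|lebesgue. f y (t0 + t))"
    using lebesgue_integral_real_affine [of 1 "f y" t0] by simp
  also have "\<dots> = exp (\<i> * of_real (t0 * \<omega>)) * (LINT t|lebesgue. f x t)"
    by (simp add: shifted)
  finally show ?thesis
    by (simp add: NFrAF \<omega>_def mult.left_commute)
qed

end
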